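(* Let $L^*>0$, $u>0$, $w>0$. The ordinary differential equation $$\frac{d}{dr}\epsilon(r)=-\frac{1}{L^*}\min\{u,w\}\,\epsilon(r)$$ is asymptotically stable and converges to $\epsilon(\infty)=0$; that is, the equilibrium $\epsilon=0$ is asymptotically stable, and $\epsilon(r)\to 0$ as $r\to\infty$ for the solution with initial value $\epsilon(0)=\epsilon$.
   Context: Here $r$ is the (continuous) day variable and $\epsilon(r)$ is a real-valued function, representing a small perturbation (an amount of density displaced from a bottom cell of length $L^*$ to the adjacent upstream cell of length $L^*$) of the equilibrium state of an LWR model with triangular fundamental diagram $Q(k)=\min\{uk,w(\kappa-k)\}$, where $u$ and $w$ are positive speeds and $\kappa$ is the jam density. *)

theory Defs
  imports "HOL-Analysis.Analysis"
begin

text \<open>Forward solutions of an autonomous equation \<open>x' = f x\<close> on the half-line \<open>{0..}\<close>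
  (one-sided derivative at \<open>0\<close>). Values of \<open>x\<close> at negative times are irrelevant.\<close>

definition global_solution :: "('a::real_normed_vector \<Rightarrow> 'a) \<Rightarrow> (real \<Rightarrow> 'a) \<Rightarrow> bool" where
  "global_solution f x \<longleftrightarrow>
     (\<forall>t\<ge>0. (x has_vector_derivative f (x t)) (at t within {0..}))"

definition equilibrium :: "('a::real_normed_vector \<Rightarrow> 'a) \<Rightarrow> 'a \<Rightarrow> bool" where
  "equilibrium f p \<longleftrightarrow> f p = 0"

text \<open>Lyapunov stability and local attractivity. Global existence for initial values near the
  equilibrium is part of both notions, so that they never hold vacuously.\<close>

definition lyapunov_stable :: "('a::real_normed_vector \<Rightarrow> 'a) \<Rightarrow> 'a \<Rightarrow> bool" where
  "lyapunov_stable f p \<longleftrightarrow>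
     (\<forall>e>0. \<exists>d>0. \<forall>x0. dist x0 p < d \<longrightarrow>
        (\<exists>x. global_solution f x \<and> x 0 = x0) \<and>
        (\<forall>x. global_solution f x \<and> x 0 = x0 \<longrightarrow> (\<forall>t\<ge>0. dist (x t) p < e)))"

definition locally_attractive :: "('a::real_normed_vector \<Rightarrow> 'a) \<Rightarrow> 'a \<Rightarrow> bool" where
  "locally_attractive f p \<longleftrightarrow>
     (\<exists>d>0. \<forall>x0. dist x0 p < d \<longrightarrow>
        (\<exists>x. global_solution f x \<and> x 0 = x0) \<and>
        (\<forall>x. global_solution f x \<and> x 0 = x0 \<longrightarrow> (x \<longlongrightarrow> p) at_top))"

definition asymptotically_stable :: "('a::real_normed_vector \<Rightarrow> 'a) \<Rightarrow> 'a \<Rightarrow> bool" where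
  "asymptotically_stable f p \<longleftrightarrow>
     equilibrium f p \<and> lyapunov_stable f p \<and> locally_attractive f p"

definition perturbation_rhs :: "real \<Rightarrow> real \<Rightarrow> real \<Rightarrow> real \<Rightarrow> real" where
  "perturbation_rhs L u w \<epsilon> = - (1 / L) * min u w * \<epsilon>"

end

theory Submission
  imports Defs
begin

text \<open>The right-hand side is linear, with the negative coefficient \<open>- a\<close> for
  \<open>a = min u w / L\<close>, so everything follows from the explicit solution
  \<open>t \<mapsto> exp (- a * t) * \<epsilon>0\<close>. An integrating factor shows that it is the only one
  (\<open>global_solution_linear_unique\<close>). Hence no solution ever moves farther from \<open>0\<close> than it
  started, which gives Lyapunov stability with \<open>d = e\<close>, and every solution decays
  exponentially, which gives attractivity from any initial value
  (\<open>linear_decay_tendsto_0\<close>).\<close>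

text \<open>For uniqueness, multiply a solution by the integrating factor \<open>exp (- c * t)\<close>: the
  product has zero derivative on the convex set \<open>{0..}\<close>, hence stays at its initial value.\<close>

lemma global_solution_linear_unique:
  fixes x :: "real \<Rightarrow> 'a::real_normed_vector"
  assumes "global_solution (\<lambda>y. c *\<^sub>R y) x" and "t \<ge> 0"
  shows "x t = exp (c * t) *\<^sub>R x 0"
proof -
  have "((\<lambda>s. exp (- c * s) *\<^sub>R x s) has_vector_derivative 0) (at s within {0..})"
    if "s \<in> {0..}" for s
  proof -
    have x: "(x has_vector_derivative c *\<^sub>R x s) (at s within {0..})"
      using assms(1) that by (simp add: global_solution_def)
    have "((\<lambda>s. exp (- c * s)) has_real_derivative - c * exp (- c * s)) (at s within {0..})"
      by (auto intro!: derivative_eq_intros)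
    from has_vector_derivative_scaleR[OF this x] show ?thesis
      by (simp add: mult.commute)
  qed
  from has_vector_derivative_zero_constant[OF convex_real_interval(1) this]
  obtain k where k: "\<And>s. s \<in> {0..} \<Longrightarrow> exp (- c * s) *\<^sub>R x s = k"
    by blast
  have "exp (- c * t) *\<^sub>R x t = x 0"
    using k[of t] k[of 0] \<open>t \<ge> 0\<close> by simp
  then have "exp (c * t) *\<^sub>R x 0 = exp (c * t) *\<^sub>R (exp (- c * t) *\<^sub>R x t)"
    by simp
  also have "\<dots> = x t"
    by (simp flip: exp_add)
  finally show ?thesis ..
qed

lemma global_solution_linear_exp:
  fixes x0 :: "'a::real_normed_vector"
  shows "global_solution (\<lambda>y. c *\<^sub>R y) (\<lambda>t. exp (c * t) *\<^sub>R x0)"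
  unfolding global_solution_def
proof (intro allI impI)
  fix t :: real
  have "((\<lambda>t. exp (c * t)) has_real_derivative c * exp (c * t)) (at t within {0..})"
    by (auto intro!: derivative_eq_intros)
  from has_vector_derivative_scaleR[OF this has_vector_derivative_const[of x0]]
  show "((\<lambda>t. exp (c * t) *\<^sub>R x0) has_vector_derivative c *\<^sub>R (exp (c * t) *\<^sub>R x0))
      (at t within {0..})"
    by simp
qed

lemma linear_decay_tendsto_0:
  fixes x :: "real \<Rightarrow> 'a::real_normed_vector"
  assumes "a > 0" and x: "global_solution (\<lambda>y. (- a) *\<^sub>R y) x"
  shows "(x \<longlongrightarrow> 0) at_top"
proof -
  have "filterlim (\<lambda>t. - a * t) at_bot at_top"
    using \<open>a > 0\<close> by (intro filterlim_tendsto_neg_mult_at_bot[OF tendsto_const])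
      (auto simp: filterlim_ident)
  then have "((\<lambda>t. exp (- a * t)) \<longlongrightarrow> 0) at_top"
    by (rule filterlim_compose[OF exp_at_bot])
  then have "((\<lambda>t. exp (- a * t) *\<^sub>R x 0) \<longlongrightarrow> 0) at_top"
    using tendsto_scaleR[of "\<lambda>t. exp (- a * t)" 0 at_top "\<lambda>_. x 0" "x 0"] by simp
  moreover have "\<forall>\<^sub>F t in at_top. exp (- a * t) *\<^sub>R x 0 = x t"
    using eventually_ge_at_top[of 0]
    by eventually_elim (rule global_solution_linear_unique[OF x, symmetric])
  ultimately show ?thesis
    by (rule Lim_transform_eventually)
qed

lemma linear_decay_norm_le:
  fixes x :: "real \<Rightarrow> 'a::real_normed_vector"
  assumes "a > 0" and x: "global_solution (\<lambda>y. (- a) *\<^sub>R y) x" and "t \<ge> 0"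
  shows "norm (x t) \<le> norm (x 0)"
proof -
  have "norm (x t) = exp (- a * t) * norm (x 0)"
    by (subst global_solution_linear_unique[OF x \<open>t \<ge> 0\<close>]) simp
  also have "\<dots> \<le> 1 * norm (x 0)"
    using \<open>a > 0\<close> \<open>t \<ge> 0\<close> by (intro mult_right_mono) auto
  finally show ?thesis by simp
qed

lemma linear_decay_asymptotically_stable:
  assumes "a > 0"
  shows "asymptotically_stable (\<lambda>y::'a::real_normed_vector. (- a) *\<^sub>R y) 0"
proof -
  let ?f = "\<lambda>y::'a. (- a) *\<^sub>R y"
  have ex: "\<exists>x. global_solution ?f x \<and> x 0 = x0" for x0
    using global_solution_linear_exp[of "- a" x0]
    by (intro exI[of _ "\<lambda>t. exp (- a * t) *\<^sub>R x0"]) simp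
  have "lyapunov_stable ?f 0"
    unfolding lyapunov_stable_def
  proof (intro allI impI)
    fix e :: real
    assume "e > 0"
    show "\<exists>d>0. \<forall>x0. dist x0 0 < d \<longrightarrow> (\<exists>x. global_solution ?f x \<and> x 0 = x0) \<and>
        (\<forall>x. global_solution ?f x \<and> x 0 = x0 \<longrightarrow> (\<forall>t\<ge>0. dist (x t) 0 < e))"
    proof (intro exI[of _ e] conjI allI impI ex \<open>e > 0\<close>; elim conjE)
      fix x0 x and t :: real
      assume "dist x0 0 < e" "global_solution ?f x" "x 0 = x0" "t \<ge> 0"
      then show "dist (x t) 0 < e"
        using linear_decay_norm_le[OF assms, of x t] by simp
    qed
  qed
  moreover have "locally_attractive ?f 0"
    unfolding locally_attractive_def
    \<comment> \<open>Attraction is global, so the radius \<open>1\<close> is an arbitrary choice.\<close>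
  proof (intro exI[of _ "1::real"] conjI allI impI zero_less_one ex; elim conjE)
    fix x
    assume "global_solution ?f x"
    then show "(x \<longlongrightarrow> 0) at_top"
      by (rule linear_decay_tendsto_0[OF assms])
  qed
  ultimately show ?thesis
    by (simp add: asymptotically_stable_def equilibrium_def)
qed

theorem theorem6p2:
  fixes L u w :: real
  assumes "L > 0" and "u > 0" and "w > 0"
  shows "asymptotically_stable (perturbation_rhs L u w) 0 \<and>
    (\<forall>\<epsilon>0::real. \<exists>\<epsilon>::real \<Rightarrow> real.
       global_solution (perturbation_rhs L u w) \<epsilon> \<and> \<epsilon> 0 = \<epsilon>0 \<and>
       (\<forall>\<eta>. global_solution (perturbation_rhs L u w) \<eta> \<and> \<eta> 0 = \<epsilon>0 \<longrightarrow>
          (\<forall>r\<ge>0. \<eta> r = \<epsilon> r)) \<and>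
       (\<epsilon> \<longlongrightarrow> 0) at_top)"
proof -
  define a where "a = min u w / L"
  have "a > 0"
    using assms by (simp add: a_def)
  have rhs: "perturbation_rhs L u w = (\<lambda>y. (- a) *\<^sub>R y)"
    by (simp add: fun_eq_iff perturbation_rhs_def a_def)
  show ?thesis
    unfolding rhs
  proof (intro conjI allI)
    show "asymptotically_stable (\<lambda>y::real. (- a) *\<^sub>R y) 0"
      by (rule linear_decay_asymptotically_stable[OF \<open>a > 0\<close>])
    fix \<epsilon>0 :: real
    let ?\<epsilon> = "\<lambda>t. exp (- a * t) *\<^sub>R \<epsilon>0"
    have sol: "global_solution (\<lambda>y. (- a) *\<^sub>R y) ?\<epsilon>"
      by (rule global_solution_linear_exp)
    show "\<exists>\<epsilon>. global_solution (\<lambda>y. (- a) *\<^sub>R y) \<epsilon> \<and> \<epsilon> 0 = \<epsilon>0 \<and>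
        (\<forall>\<eta>. global_solution (\<lambda>y. (- a) *\<^sub>R y) \<eta> \<and> \<eta> 0 = \<epsilon>0 \<longrightarrow> (\<forall>r\<ge>0. \<eta> r = \<epsilon> r)) \<and>
        (\<epsilon> \<longlongrightarrow> 0) at_top"
    proof (intro exI[of _ ?\<epsilon>] conjI allI impI sol; (elim conjE)?)
      show "exp (- a * 0) *\<^sub>R \<epsilon>0 = \<epsilon>0"
        by simp
      show "(?\<epsilon> \<longlongrightarrow> 0) at_top"
        by (rule linear_decay_tendsto_0[OF \<open>a > 0\<close> sol])
      fix \<eta> and r :: real
      assume \<eta>: "global_solution (\<lambda>y. (- a) *\<^sub>R y) \<eta>" "\<eta> 0 = \<epsilon>0" and "r \<ge> 0"
      show "\<eta> r = ?\<epsilon> r"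
        using global_solution_linear_unique[OF \<eta>(1) \<open>r \<ge> 0\<close>] by (simp only: \<eta>(2))
    qed
  qed
qed

end
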